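(* Let $q$ be a prime power and $k>1$ an integer. Let $\Pi = PG(2,q^k)$, let $\pi = PG(2,q)$ be a subplane of $\Pi$, choose a point $D$ of $\pi$, let $\mathcal{S}$ be the set of lines $\overline{Dp}$ of $\Pi$ with $p$ a point of $\pi$ other than $D$, let $\mathcal{P}=\bigcup\mathcal{S}$, and let $\mathcal{O}$ be the set of restrictions $L\cap\mathcal{P}$ of the lines $L$ of $\Pi$ not containing $D$. Then the incidence structure $R(q,q^k)$ with point set $\mathcal{P}$ and line set $\mathcal{S}\cup\mathcal{O}$ (incidence being membership) is a projective rectangle with special point $D$.
   Context: A projective rectangle is an incidence structure satisfying: (A1) every two distinct points are incident with exactly one line; (A2) there exist four points no three of which are collinear; (A3) every line is incident with at least three distinct points; (A4) there is a distinguished point $D$, the special point; lines incident with $D$ are called special, lines not incident with $D$ are called ordinary; (A5) each special line intersects every other line in exactly one point; (A6) if two ordinary lines $l_1,l_2$ intersect in a point, then every two lines that intersect both $l_1$ and $l_2$ in four distinct points intersect in a point. *)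

theory Defs
  imports "HOL-Analysis.Analysis" "HOL-Number_Theory.Prime_Powers"
begin

record ('p, 'l) incidence_structure =
  Points :: "'p set"
  Lines :: "'l set"
  Inc :: "'p \<Rightarrow> 'l \<Rightarrow> bool"

definition meet_in_point :: "('p, 'l) incidence_structure \<Rightarrow> 'l \<Rightarrow> 'l \<Rightarrow> bool" where
  "meet_in_point R l m \<longleftrightarrow> (\<exists>p\<in>Points R. Inc R p l \<and> Inc R p m)"

definition collinear_in :: "('p, 'l) incidence_structure \<Rightarrow> 'p set \<Rightarrow> bool" where
  "collinear_in R A \<longleftrightarrow> (\<exists>l\<in>Lines R. \<forall>p\<in>A. Inc R p l)"

definition has_unique_joins :: "('p, 'l) incidence_structure \<Rightarrow> bool" where
  "has_unique_joins R \<longleftrightarrow>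
     (\<forall>p\<in>Points R. \<forall>p'\<in>Points R. p \<noteq> p' \<longrightarrow> (\<exists>!l. l \<in> Lines R \<and> Inc R p l \<and> Inc R p' l))"

definition has_quadrangle :: "('p, 'l) incidence_structure \<Rightarrow> bool" where
  "has_quadrangle R \<longleftrightarrow>
     (\<exists>Q \<subseteq> Points R. card Q = 4 \<and> (\<forall>T \<subseteq> Q. card T = 3 \<longrightarrow> \<not> collinear_in R T))"

definition projective_plane :: "('p, 'l) incidence_structure \<Rightarrow> bool" where
  "projective_plane R \<longleftrightarrow>
     has_unique_joins R \<and>
     (\<forall>l\<in>Lines R. \<forall>m\<in>Lines R. l \<noteq> m \<longrightarrow> (\<exists>!p. p \<in> Points R \<and> Inc R p l \<and> Inc R p m)) \<and>
     has_quadrangle R"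

text \<open>
  A line of a subplane is identified with the line of the ambient plane that carries it, so when
  lines are point sets, a line of the subplane may contain points outside the subplane.
\<close>

definition subplane :: "('p, 'l) incidence_structure \<Rightarrow> ('p, 'l) incidence_structure \<Rightarrow> bool" where
  "subplane S R \<longleftrightarrow>
     projective_plane S \<and> Points S \<subseteq> Points R \<and> Lines S \<subseteq> Lines R \<and>
     (\<forall>p\<in>Points S. \<forall>l\<in>Lines S. Inc S p l \<longleftrightarrow> Inc R p l)"

definition isomorphic_incidence ::
    "('p, 'l) incidence_structure \<Rightarrow> ('p', 'l') incidence_structure \<Rightarrow> bool" where
  "isomorphic_incidence R S \<longleftrightarrow>
     (\<exists>f g. bij_betw f (Points R) (Points S) \<and> bij_betw g (Lines R) (Lines S) \<and>
        (\<forall>p\<in>Points R. \<forall>l\<in>Lines R. Inc R p l \<longleftrightarrow> Inc S (f p) (g l)))"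

text \<open>
  The plane over the field \<open>'a\<close>: points are the one-dimensional subspaces of \<open>'a ^ 3\<close>, and a line
  is the set of all points lying in a given two-dimensional subspace.
\<close>

definition PG2_points :: "('a::field ^ 3) set set" where
  "PG2_points = {U. vec.subspace U \<and> vec.dim U = 1}"

definition PG2 :: "(('a::field ^ 3) set, ('a ^ 3) set set) incidence_structure" where
  "PG2 = \<lparr>Points = PG2_points,
          Lines = {{U \<in> PG2_points. U \<subseteq> W} | W. vec.subspace W \<and> vec.dim W = 2},
          Inc = (\<in>)\<rparr>"

definition projective_rectangle :: "('p, 'l) incidence_structure \<Rightarrow> 'p \<Rightarrow> bool" where
  "projective_rectangle R D \<longleftrightarrow>
     has_unique_joins R \<and>
     has_quadrangle R \<and>
     (\<forall>l\<in>Lines R. \<exists>A \<subseteq> Points R. card A = 3 \<and> (\<forall>p\<in>A. Inc R p l)) \<and>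
     D \<in> Points R \<and>
     (\<forall>s\<in>Lines R. \<forall>l\<in>Lines R. Inc R D s \<and> l \<noteq> s \<longrightarrow>
        (\<exists>!p. p \<in> Points R \<and> Inc R p s \<and> Inc R p l)) \<and>
     (\<forall>l1\<in>Lines R. \<forall>l2\<in>Lines R.
        \<not> Inc R D l1 \<and> \<not> Inc R D l2 \<and> l1 \<noteq> l2 \<and> meet_in_point R l1 l2 \<longrightarrow>
        (\<forall>m1\<in>Lines R. \<forall>m2\<in>Lines R. m1 \<noteq> m2 \<and>
           (\<exists>p11\<in>Points R. \<exists>p12\<in>Points R. \<exists>p21\<in>Points R. \<exists>p22\<in>Points R.
              distinct [p11, p12, p21, p22] \<and>
              Inc R p11 m1 \<and> Inc R p11 l1 \<and> Inc R p12 m1 \<and> Inc R p12 l2 \<and>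
              Inc R p21 m2 \<and> Inc R p21 l1 \<and> Inc R p22 m2 \<and> Inc R p22 l2) \<longrightarrow>
           meet_in_point R m1 m2))"

text \<open>
  In the following three definitions \<open>Pl\<close> is the ambient plane, its lines are point sets with
  membership as incidence, and \<open>S\<close> is the subplane.
\<close>

definition rect_special_lines ::
    "('p, 'p set) incidence_structure \<Rightarrow> ('p, 'p set) incidence_structure \<Rightarrow> 'p \<Rightarrow> 'p set set" where
  "rect_special_lines Pl S D = {L \<in> Lines Pl. \<exists>p\<in>Points S. p \<noteq> D \<and> D \<in> L \<and> p \<in> L}"

definition rect_ordinary_lines ::
    "('p, 'p set) incidence_structure \<Rightarrow> ('p, 'p set) incidence_structure \<Rightarrow> 'p \<Rightarrow> 'p set set" where
  "rect_ordinary_lines Pl S D = {L \<inter> \<Union>(rect_special_lines Pl S D) | L. L \<in> Lines Pl \<and> D \<notin> L}"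

definition subplane_rectangle ::
    "('p, 'p set) incidence_structure \<Rightarrow> ('p, 'p set) incidence_structure \<Rightarrow> 'p \<Rightarrow>
     ('p, 'p set) incidence_structure" where
  "subplane_rectangle Pl S D =
     \<lparr>Points = \<Union>(rect_special_lines Pl S D),
      Lines = rect_special_lines Pl S D \<union> rect_ordinary_lines Pl S D,
      Inc = (\<in>)\<rparr>"

end

theory Submission
  imports Defs
begin

text \<open>
  All axioms but (A6) hold for a subplane of an arbitrary projective plane, because the special
  lines are exactly the lines of the subplane through \<open>D\<close>. Axiom (A6) comes from a closure property
  of the ambient plane: if two quadrilaterals of lines missing \<open>D\<close> have five pairs of corresponding
  vertices collinear with \<open>D\<close>, then so is the sixth pair. Given five vertices on special lines, a
  quadrilateral with corresponding vertices can be drawn inside the subplane. Its sixth vertex is a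
  point of the subplane, so the line joining it to \<open>D\<close> is special, and it carries the sixth vertex
  of the given quadrilateral.

  For the closure property, fix a vector \<open>d\<close> spanning \<open>D\<close> and describe a line missing \<open>D\<close> by the
  linear functional that vanishes on it and takes the value 1 at \<open>d\<close>. These functionals form an
  affine plane in which the line joining \<open>D\<close> to a vertex determines the direction of the difference
  of the two sides. Hence the two quadrilaterals become quadrangles with five pairs of parallel
  sides; they consist of homothetic triangles, so the sixth sides are parallel too.
\<close>

section \<open>Projective planes\<close>

definition points_on :: "('p, 'l) incidence_structure \<Rightarrow> 'l \<Rightarrow> 'p set" where
  "points_on R l = {p \<in> Points R. Inc R p l}"

definition lines_through :: "('p, 'l) incidence_structure \<Rightarrow> 'p \<Rightarrow> 'l set" where
  "lines_through R p = {l \<in> Lines R. Inc R p l}"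

definition quadrangle :: "('p, 'l) incidence_structure \<Rightarrow> 'p set \<Rightarrow> bool" where
  "quadrangle R Q \<longleftrightarrow>
     Q \<subseteq> Points R \<and> card Q = 4 \<and> (\<forall>T\<subseteq>Q. card T = 3 \<longrightarrow> \<not> collinear_in R T)"

lemma bij_betw_subset_card:
  assumes "bij_betw f A B" "\<exists>T\<subseteq>A. card T = n"
  shows "\<exists>T\<subseteq>B. card T = n"
proof -
  obtain T where T: "T \<subseteq> A" "card T = n" using assms(2) by blast
  then have "bij_betw f T (f ` T)" using bij_betw_subset[OF assms(1)] by blast
  then have "card (f ` T) = n" using bij_betw_same_card T(2) by metis
  moreover have "f ` T \<subseteq> B" using T(1) assms(1) by (auto simp: bij_betw_def)
  ultimately show ?thesis by blast
qed

lemma has_quadrangle_iff: "has_quadrangle R \<longleftrightarrow> (\<exists>Q. quadrangle R Q)"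
  by (auto simp: has_quadrangle_def quadrangle_def)

locale plane =
  fixes R :: "('p, 'l) incidence_structure"
  assumes projective_plane: "projective_plane R"
begin

lemma join_exists:
  assumes "p \<in> Points R" "q \<in> Points R" "p \<noteq> q"
  shows "\<exists>l\<in>Lines R. Inc R p l \<and> Inc R q l"
  using projective_plane assms unfolding projective_plane_def has_unique_joins_def by blast

lemma join_unique:
  assumes "l \<in> Lines R" "m \<in> Lines R" "p \<in> Points R" "q \<in> Points R" "p \<noteq> q"
    and "Inc R p l" "Inc R q l" "Inc R p m" "Inc R q m"
  shows "l = m"
  using projective_plane assms unfolding projective_plane_def has_unique_joins_def by blast

lemma meet_exists:
  assumes "l \<in> Lines R" "m \<in> Lines R" "l \<noteq> m"
  shows "\<exists>p\<in>Points R. Inc R p l \<and> Inc R p m"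
  using projective_plane assms unfolding projective_plane_def by blast

lemma quadrangle_exists:
  obtains Q where "quadrangle R Q"
  using projective_plane by (auto simp: projective_plane_def has_quadrangle_iff)

lemma pencil_bij_betw_line:
  assumes a: "a \<in> Points R" and l: "l \<in> Lines R" and "\<not> Inc R a l"
  obtains f where "bij_betw f (lines_through R a) (points_on R l)"
    and "\<And>m. m \<in> lines_through R a \<Longrightarrow> Inc R (f m) m"
proof -
  have "\<exists>p\<in>points_on R l. Inc R p m" if "m \<in> lines_through R a" for m
    using that meet_exists[OF l, of m] \<open>\<not> Inc R a l\<close>
    by (auto simp: points_on_def lines_through_def)
  then obtain f where f: "\<And>m. m \<in> lines_through R a \<Longrightarrow> f m \<in> points_on R l \<and> Inc R (f m) m"
    by metis
  have not_a: "p \<noteq> a" if "p \<in> points_on R l" for p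
    using that \<open>\<not> Inc R a l\<close> by (auto simp: points_on_def)
  have "bij_betw f (lines_through R a) (points_on R l)"
    unfolding bij_betw_def
  proof (intro conjI inj_onI equalityI subsetI)
    fix m m' assume "m \<in> lines_through R a" "m' \<in> lines_through R a" "f m = f m'"
    then show "m = m'"
      using f[of m] f[of m'] not_a[of "f m"] join_unique[of m m' a "f m"] a
      by (auto simp: points_on_def lines_through_def)
  next
    fix p assume p: "p \<in> points_on R l"
    then obtain m where m: "m \<in> lines_through R a" "Inc R p m"
      using join_exists[of a p] a not_a by (auto simp: points_on_def lines_through_def)
    then have "f m = p"
      using f[OF m(1)] p join_unique[OF l, of m p "f m"] \<open>\<not> Inc R a l\<close>
      by (auto simp: points_on_def lines_through_def)
    with m show "p \<in> f ` lines_through R a" by blast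
  qed (use f in blast)
  with f that show thesis by blast
qed

lemma three_lines_through_quadrangle_point:
  assumes Q: "quadrangle R Q" and a: "a \<in> Q"
  shows "\<exists>A\<subseteq>lines_through R a. card A = 3"
proof -
  have fin: "finite Q" and sub: "Q \<subseteq> Points R" and card: "card Q = 4"
    using Q by (auto simp: quadrangle_def intro: card_ge_0_finite)
  have "\<exists>l\<in>lines_through R a. Inc R p l" if "p \<in> Q - {a}" for p
    using join_exists[of a p] a that sub by (auto simp: lines_through_def)
  then obtain f where f: "\<And>p. p \<in> Q - {a} \<Longrightarrow> f p \<in> lines_through R a \<and> Inc R p (f p)"
    by metis
  have "inj_on f (Q - {a})"
  proof (rule inj_onI, rule ccontr)
    fix p q assume pq: "p \<in> Q - {a}" "q \<in> Q - {a}" "f p = f q" "p \<noteq> q"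
    then have "collinear_in R {a, p, q}"
      using f[of p] f[of q] by (auto simp: collinear_in_def lines_through_def)
    moreover have "card {a, p, q} = 3" "{a, p, q} \<subseteq> Q"
      using pq a by auto
    ultimately show False using Q by (auto simp: quadrangle_def)
  qed
  then have "card (f ` (Q - {a})) = 3"
    using fin card a by (simp add: card_image)
  moreover have "f ` (Q - {a}) \<subseteq> lines_through R a" using f by blast
  ultimately show ?thesis by blast
qed

lemma three_points_on_line:
  assumes l: "l \<in> Lines R"
  shows "\<exists>A\<subseteq>points_on R l. card A = 3"
proof -
  obtain Q where Q: "quadrangle R Q" by (rule quadrangle_exists)
  then have "3 \<le> card Q" by (simp add: quadrangle_def)
  then obtain T where T: "T \<subseteq> Q" "card T = 3"
    by (rule obtain_subset_with_card_n)
  then obtain a where a: "a \<in> Q" "\<not> Inc R a l"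
    using Q l unfolding quadrangle_def collinear_in_def by blast
  then have "a \<in> Points R" using Q by (auto simp: quadrangle_def)
  then obtain f where f: "bij_betw f (lines_through R a) (points_on R l)"
    using pencil_bij_betw_line l a by blast
  then show ?thesis
    using bij_betw_subset_card three_lines_through_quadrangle_point[OF Q a(1)] by blast
qed

lemma line_avoiding_point_exists:
  assumes "p \<in> Points R"
  shows "\<exists>l\<in>Lines R. \<not> Inc R p l"
proof -
  obtain Q where Q: "quadrangle R Q" by (rule quadrangle_exists)
  then have "\<not> Q \<subseteq> {p}"
    using card_mono[of "{p}" Q] by (auto simp: quadrangle_def)
  then obtain a where a: "a \<in> Q" "a \<noteq> p" "a \<in> Points R"
    using Q by (auto simp: quadrangle_def)
  obtain l m where "l \<in> lines_through R a" "m \<in> lines_through R a" "l \<noteq> m"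
    using three_lines_through_quadrangle_point[OF Q a(1)] by (auto simp: card_3_iff)
  then show ?thesis
    using join_unique[of l m a p] assms a by (auto simp: lines_through_def)
qed

lemma three_lines_through_point:
  assumes p: "p \<in> Points R"
  shows "\<exists>A\<subseteq>lines_through R p. card A = 3"
proof -
  obtain l where l: "l \<in> Lines R" "\<not> Inc R p l"
    using line_avoiding_point_exists[OF p] by blast
  then obtain f where f: "bij_betw f (lines_through R p) (points_on R l)"
    using pencil_bij_betw_line[OF p] by blast
  then show ?thesis
    using bij_betw_subset_card[OF bij_betw_inv_into] three_points_on_line[OF l(1)] by blast
qed

end

section \<open>The sixth vertex of a quadrilateral\<close>

definition concurrent :: "('p, 'l) incidence_structure \<Rightarrow> 'l set \<Rightarrow> bool" where
  "concurrent R A \<longleftrightarrow> (\<exists>p\<in>Points R. \<forall>l\<in>A. Inc R p l)"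

definition perspective_meets ::
    "('p, 'l) incidence_structure \<Rightarrow> 'p \<Rightarrow> 'l \<Rightarrow> 'l \<Rightarrow> 'l \<Rightarrow> 'l \<Rightarrow> bool" where
  "perspective_meets R D l m l' m' \<longleftrightarrow>
     (\<exists>s\<in>lines_through R D. concurrent R {s, l, m} \<and> concurrent R {s, l', m'})"

definition sixth_vertex_property :: "('p, 'l) incidence_structure \<Rightarrow> 'p \<Rightarrow> bool" where
  "sixth_vertex_property R D \<longleftrightarrow>
     (\<forall>l1 l2 m1 m2 l1' l2' m1' m2'.
        (\<forall>l\<in>{l1, l2, m1, m2, l1', l2', m1', m2'}. l \<in> Lines R \<and> \<not> Inc R D l) \<longrightarrow>
        \<not> concurrent R {l1, l2, m1} \<longrightarrow> \<not> concurrent R {l1, l2, m2} \<longrightarrow>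
        perspective_meets R D l1 l2 l1' l2' \<longrightarrow>
        perspective_meets R D l1 m1 l1' m1' \<longrightarrow> perspective_meets R D l2 m1 l2' m1' \<longrightarrow>
        perspective_meets R D l1 m2 l1' m2' \<longrightarrow> perspective_meets R D l2 m2 l2' m2' \<longrightarrow>
        perspective_meets R D m1 m2 m1' m2')"

section \<open>The rectangle of a subplane\<close>

locale pointed_subplane = ambient: plane Pl
  for Pl :: "('p, 'p set) incidence_structure" +
  fixes S :: "('p, 'p set) incidence_structure" and D :: 'p
  assumes Inc_ambient: "Inc Pl = (\<in>)"
    and line_subset_points: "L \<in> Lines Pl \<Longrightarrow> L \<subseteq> Points Pl"
    and subplane: "subplane S Pl"
    and D_in_subplane: "D \<in> Points S"

sublocale pointed_subplane \<subseteq> sub: plane S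
  using subplane by unfold_locales (simp add: subplane_def)

context pointed_subplane
begin

abbreviation special :: "'p set set" where
  "special \<equiv> rect_special_lines Pl S D"

abbreviation rect_points :: "'p set" where
  "rect_points \<equiv> \<Union>special"

abbreviation rect :: "('p, 'p set) incidence_structure" where
  "rect \<equiv> subplane_rectangle Pl S D"

lemma subplane_point: "p \<in> Points S \<Longrightarrow> p \<in> Points Pl"
  and subplane_line: "L \<in> Lines S \<Longrightarrow> L \<in> Lines Pl"
  and Inc_subplane: "p \<in> Points S \<Longrightarrow> L \<in> Lines S \<Longrightarrow> Inc S p L \<longleftrightarrow> p \<in> L"
  using subplane by (auto simp: subplane_def Inc_ambient)

lemma ambient_line_unique:
  assumes "L \<in> Lines Pl" "M \<in> Lines Pl" "p \<noteq> q" "p \<in> L" "q \<in> L" "p \<in> M" "q \<in> M"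
  shows "L = M"
  using assms ambient.join_unique[of L M p q] line_subset_points by (auto simp: Inc_ambient)

lemma subplane_join_exists:
  assumes "p \<in> Points S" "q \<in> Points S" "p \<noteq> q"
  shows "\<exists>L\<in>Lines S. p \<in> L \<and> q \<in> L"
  using sub.join_exists[OF assms] assms Inc_subplane by blast

lemma subplane_meet_exists:
  assumes "L \<in> Lines S" "M \<in> Lines S" "L \<noteq> M"
  shows "\<exists>p\<in>Points S. p \<in> L \<and> p \<in> M"
  using sub.meet_exists[OF assms] assms Inc_subplane by blast

lemma ambient_line_in_subplane:
  assumes "L \<in> Lines Pl" "p \<in> Points S" "q \<in> Points S" "p \<noteq> q" "p \<in> L" "q \<in> L"
  shows "L \<in> Lines S"
  using assms subplane_join_exists ambient_line_unique subplane_line by metis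

lemma special_ambient_line: "s \<in> special \<Longrightarrow> s \<in> Lines Pl"
  by (auto simp: rect_special_lines_def)

lemma D_in_special: "s \<in> special \<Longrightarrow> D \<in> s"
  by (auto simp: rect_special_lines_def)

lemma special_second_point:
  assumes "s \<in> special"
  obtains p where "p \<in> Points S" "p \<in> s" "p \<noteq> D"
  using assms by (auto simp: rect_special_lines_def)

lemma special_eq_lines_through: "special = lines_through S D"
proof (intro equalityI subsetI)
  fix s assume "s \<in> special"
  then show "s \<in> lines_through S D"
    using ambient_line_in_subplane[of s D] D_in_subplane Inc_subplane
    by (auto simp: rect_special_lines_def lines_through_def)
next
  fix s assume "s \<in> lines_through S D"
  then have s: "s \<in> Lines S" "D \<in> s"
    using D_in_subplane Inc_subplane by (auto simp: lines_through_def)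
  then obtain A where A: "A \<subseteq> points_on S s" "card A = 3"
    using sub.three_points_on_line by blast
  then have "\<not> A \<subseteq> {D}" using card_mono[of "{D}" A] by auto
  then obtain p where "p \<in> Points S" "p \<in> s" "p \<noteq> D"
    using A(1) s(1) Inc_subplane by (auto simp: points_on_def)
  with s show "s \<in> special"
    using subplane_line by (auto simp: rect_special_lines_def)
qed

lemma special_subplane_line: "s \<in> special \<Longrightarrow> s \<in> Lines S"
  by (auto simp: special_eq_lines_through lines_through_def)

lemma three_special_lines: "\<exists>A\<subseteq>special. card A = 3"
  using sub.three_lines_through_point[OF D_in_subplane] by (simp add: special_eq_lines_through)

lemma line_through_D_special:
  assumes "L \<in> Lines Pl" "D \<in> L" "p \<in> L" "p \<in> rect_points" "p \<noteq> D"
  shows "L \<in> special"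
proof -
  obtain s where "s \<in> special" "p \<in> s" using assms(4) by blast
  moreover from this have "L = s"
    using assms ambient_line_unique[of L s D p] special_ambient_line D_in_special by blast
  ultimately show ?thesis by simp
qed

lemma special_line_eq_iff:
  assumes "L \<in> Lines Pl" "D \<notin> L" "s \<in> special" "t \<in> special"
    and "p \<in> s" "p \<in> L" "q \<in> t" "q \<in> L"
  shows "s = t \<longleftrightarrow> p = q"
proof
  assume "s = t"
  then show "p = q"
    using assms ambient_line_unique[of L s p q] special_ambient_line D_in_special by blast
next
  assume "p = q"
  then show "s = t"
    using assms ambient_line_unique[of s t D p] special_ambient_line D_in_special by blast
qed

lemma D_in_rect: "D \<in> rect_points"
proof -
  obtain A where "A \<subseteq> special" "card A = 3" using three_special_lines by blast
  then have "special \<noteq> {}" by auto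
  then show ?thesis using D_in_special by blast
qed

lemma subplane_points_subset_rect: "Points S \<subseteq> rect_points"
proof
  fix p assume p: "p \<in> Points S"
  show "p \<in> rect_points"
  proof (cases "p = D")
    case False
    then obtain L where "L \<in> Lines S" "p \<in> L" "D \<in> L"
      using subplane_join_exists p D_in_subplane by blast
    then show ?thesis
      using p False subplane_line by (auto simp: rect_special_lines_def)
  qed (use D_in_rect in simp)
qed

lemma rect_points_subset_ambient: "rect_points \<subseteq> Points Pl"
  using line_subset_points special_ambient_line by blast

lemma Points_rect [simp]: "Points rect = rect_points"
  and Inc_rect [simp]: "Inc rect = (\<in>)"
  by (simp_all add: subplane_rectangle_def)

lemma Lines_rect:
  "Lines rect = {L \<inter> rect_points | L. L \<in> Lines Pl \<and> (D \<in> L \<longrightarrow> L \<in> special)}"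
proof -
  have "s = s \<inter> rect_points" if "s \<in> special" for s using that by blast
  then have "special = {L \<inter> rect_points | L. L \<in> special}" by auto
  moreover have "{L \<inter> rect_points | L. L \<in> Lines Pl \<and> (D \<in> L \<longrightarrow> L \<in> special)}
     = {L \<inter> rect_points | L. L \<in> special} \<union> rect_ordinary_lines Pl S D"
    using special_ambient_line D_in_special unfolding rect_ordinary_lines_def by blast
  ultimately show ?thesis by (simp add: subplane_rectangle_def)
qed

lemma rect_lineE:
  assumes "l \<in> Lines rect"
  obtains L where "L \<in> Lines Pl" "D \<in> L \<Longrightarrow> L \<in> special" "l = L \<inter> rect_points"
  using assms unfolding Lines_rect by blast

lemma has_unique_joins_rect: "has_unique_joins rect"
  unfolding has_unique_joins_def Points_rect Inc_rect
proof (intro ballI impI)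
  fix p q assume p: "p \<in> rect_points" and q: "q \<in> rect_points" and neq: "p \<noteq> q"
  obtain L where L: "L \<in> Lines Pl" "p \<in> L" "q \<in> L"
    using ambient.join_exists[of p q] p q neq rect_points_subset_ambient
    by (auto simp: Inc_ambient)
  have "L \<in> special" if "D \<in> L"
    using line_through_D_special[OF L(1) that] L p q neq by blast
  then have "L \<inter> rect_points \<in> Lines rect" using L(1) unfolding Lines_rect by blast
  moreover have "l = L \<inter> rect_points" if l: "l \<in> Lines rect" "p \<in> l" "q \<in> l" for l
  proof -
    obtain M where M: "M \<in> Lines Pl" "l = M \<inter> rect_points" using rect_lineE[OF l(1)] by blast
    then have "M = L" using ambient_line_unique[OF M(1) L(1) neq] L l(2,3) by simp
    with M show ?thesis by simp
  qed
  moreover have "p \<in> L \<inter> rect_points" "q \<in> L \<inter> rect_points"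
    using L(2,3) p q by blast+
  ultimately show "\<exists>!l. l \<in> Lines rect \<and> p \<in> l \<and> q \<in> l" by metis
qed

lemma collinear_in_subplane:
  assumes "T \<subseteq> Points S" "card T = 3" "collinear_in rect T"
  shows "collinear_in S T"
proof -
  obtain l where l: "l \<in> Lines rect" "T \<subseteq> l"
    using assms(3) by (auto simp: collinear_in_def)
  obtain L where L: "L \<in> Lines Pl" "l = L \<inter> rect_points"
    using rect_lineE[OF l(1)] by blast
  with l(2) have "T \<subseteq> L" by simp
  obtain p q where "p \<in> T" "q \<in> T" "p \<noteq> q"
    using assms(2) by (auto simp: card_3_iff)
  then have "L \<in> Lines S"
    using ambient_line_in_subplane[OF L(1)] \<open>T \<subseteq> L\<close> assms(1) by blast
  moreover from this have "\<forall>p\<in>T. Inc S p L"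
    using \<open>T \<subseteq> L\<close> assms(1) Inc_subplane by blast
  ultimately show ?thesis by (auto simp: collinear_in_def)
qed

lemma has_quadrangle_rect: "has_quadrangle rect"
proof -
  obtain Q where "quadrangle S Q" by (rule sub.quadrangle_exists)
  then have "quadrangle rect Q"
    unfolding quadrangle_def Points_rect
    using collinear_in_subplane subplane_points_subset_rect by (meson subset_trans)
  then show ?thesis by (auto simp: has_quadrangle_iff)
qed

lemma three_points_on_rect_line:
  assumes "l \<in> Lines rect"
  shows "\<exists>A\<subseteq>rect_points. card A = 3 \<and> (\<forall>p\<in>A. p \<in> l)"
proof -
  obtain L where L: "L \<in> Lines Pl" "D \<in> L \<Longrightarrow> L \<in> special" "l = L \<inter> rect_points"
    using rect_lineE[OF assms] by blast
  have "\<exists>A \<subseteq> L \<inter> rect_points. card A = 3"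
  proof (cases "D \<in> L")
    case True
    then have "L \<in> Lines S" using L(2) special_subplane_line by blast
    then have "\<exists>A\<subseteq>points_on S L. card A = 3" "points_on S L \<subseteq> L \<inter> rect_points"
      using sub.three_points_on_line subplane_points_subset_rect Inc_subplane
      by (auto simp: points_on_def)
    then show ?thesis by (meson subset_trans)
  next
    case False
    have "D \<in> Points Pl" "special \<subseteq> lines_through Pl D"
      using subplane_point[OF D_in_subplane] special_ambient_line D_in_special
      by (auto simp: lines_through_def Inc_ambient)
    then obtain f where f: "bij_betw f (lines_through Pl D) (points_on Pl L)"
      "\<And>s. s \<in> lines_through Pl D \<Longrightarrow> f s \<in> s"
      using ambient.pencil_bij_betw_line[of D L] L(1) False unfolding Inc_ambient by metis
    then have "bij_betw f special (f ` special)"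
      using bij_betw_subset \<open>special \<subseteq> _\<close> by blast
    then have "\<exists>A\<subseteq>f ` special. card A = 3"
      using bij_betw_subset_card three_special_lines by blast
    moreover have "f s \<in> L \<inter> rect_points" if s: "s \<in> special" for s
    proof
      have mem: "s \<in> lines_through Pl D" using s \<open>special \<subseteq> _\<close> by blast
      show "f s \<in> L"
        using bij_betwE[OF f(1)] mem by (auto simp: points_on_def Inc_ambient)
      show "f s \<in> rect_points" using f(2)[OF mem] s by blast
    qed
    then have "f ` special \<subseteq> L \<inter> rect_points" by (rule image_subsetI)
    ultimately show ?thesis by (meson subset_trans)
  qed
  then show ?thesis using L(3) by blast
qed

lemma special_meets_rect_line:
  assumes "s \<in> Lines rect" "l \<in> Lines rect" "D \<in> s" "l \<noteq> s"
  shows "\<exists>!p. p \<in> rect_points \<and> p \<in> s \<and> p \<in> l"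
proof -
  obtain s' where s': "s' \<in> Lines Pl" "D \<in> s' \<Longrightarrow> s' \<in> special" "s = s' \<inter> rect_points"
    using rect_lineE[OF assms(1)] by blast
  then have "s' \<in> special" using assms(3) by simp
  moreover from this have "s = s'" using s'(3) by blast
  ultimately have s: "s \<in> special" "s \<in> Lines Pl" using s'(1) by simp_all
  obtain L where L: "L \<in> Lines Pl" "l = L \<inter> rect_points"
    using rect_lineE[OF assms(2)] by blast
  have "L \<noteq> s" using L s assms(4) by blast
  then obtain p where p: "p \<in> L" "p \<in> s"
    using ambient.meet_exists[OF L(1) s(2)] by (auto simp: Inc_ambient)
  show ?thesis
    using p s L ambient_line_unique[OF L(1) s(2)] \<open>L \<noteq> s\<close> by blast
qed

lemma concurrent_ambient_iff:
  assumes "L \<in> Lines Pl"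
  shows "concurrent Pl (insert L A) \<longleftrightarrow> (\<exists>p\<in>L. \<forall>M\<in>A. p \<in> M)"
  using line_subset_points[OF assms] by (auto simp: concurrent_def Inc_ambient)

lemma not_concurrent_triangle:
  assumes "L \<in> Lines Pl" "M \<in> Lines Pl" "N \<in> Lines Pl" "L \<noteq> N" "M \<noteq> N"
    and "p \<noteq> q" "p \<in> N" "p \<in> L" "q \<in> N" "q \<in> M"
  shows "\<not> concurrent Pl {L, M, N}"
  using assms ambient_line_unique unfolding concurrent_ambient_iff[OF assms(1)]
  by (metis insertI1 insertI2)

lemma special_through_meet_unique:
  assumes s: "s \<in> special" "t \<in> special"
    and LM: "L \<in> Lines Pl" "M \<in> Lines Pl" "L \<noteq> M" "D \<notin> L"
    and "concurrent Pl {s, L, M}" "concurrent Pl {t, L, M}"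
  shows "s = t"
proof -
  have "s \<in> Lines Pl" "t \<in> Lines Pl" using s special_ambient_line by auto
  then obtain p q where "p \<in> s" "p \<in> L" "p \<in> M" "q \<in> t" "q \<in> L" "q \<in> M"
    using assms(7,8) by (auto simp: concurrent_ambient_iff)
  moreover from this have "p = q" using ambient_line_unique LM(1-3) by blast
  ultimately show ?thesis using special_line_eq_iff[OF LM(1,4) s] by blast
qed

lemma two_ordinary_lines_through_subplane_point:
  assumes p: "p \<in> Points S" "p \<noteq> D"
  obtains L M where "L \<in> Lines S" "M \<in> Lines S" "L \<noteq> M" "p \<in> L" "p \<in> M" "D \<notin> L" "D \<notin> M"
proof -
  obtain A where A: "A \<subseteq> lines_through S p" "card A = 3"
    using sub.three_lines_through_point[OF p(1)] by blast
  then obtain L1 L2 L3 where A_eq: "A = {L1, L2, L3}" and "L1 \<noteq> L2" "L2 \<noteq> L3" "L1 \<noteq> L3"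
    by (auto simp: card_3_iff)
  have through: "L \<in> Lines S" "p \<in> L" if "L \<in> A" for L
    using that A(1) p Inc_subplane by (auto simp: lines_through_def)
  have "L = M" if "L \<in> A" "M \<in> A" "D \<in> L" "D \<in> M" for L M
    using ambient_line_unique[of L M D p] subplane_line through that p(2) by blast
  then consider "D \<notin> L1" "D \<notin> L2" | "D \<notin> L2" "D \<notin> L3" | "D \<notin> L1" "D \<notin> L3"
    using A_eq \<open>L1 \<noteq> L2\<close> \<open>L2 \<noteq> L3\<close> \<open>L1 \<noteq> L3\<close> by blast
  then show thesis
  proof cases
    case 1
    then show thesis using that[of L1 L2] through A_eq \<open>L1 \<noteq> L2\<close> by simp
  next
    case 2
    then show thesis using that[of L2 L3] through A_eq \<open>L2 \<noteq> L3\<close> by simp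
  next
    case 3
    then show thesis using that[of L1 L3] through A_eq \<open>L1 \<noteq> L3\<close> by simp
  qed
qed

lemma subplane_transversal_exists:
  assumes L: "L1 \<in> Lines S" "L2 \<in> Lines S" "D \<notin> L1" "D \<notin> L2"
    and s: "s1 \<in> special" "s2 \<in> special" "s1 \<noteq> s2"
  obtains M where "M \<in> Lines S" "D \<notin> M" "concurrent Pl {s1, L1, M}" "concurrent Pl {s2, L2, M}"
proof -
  have lines: "s1 \<in> Lines Pl" "s2 \<in> Lines Pl" "D \<in> s1" "D \<in> s2"
    using s special_ambient_line D_in_special by auto
  obtain p1 where p1: "p1 \<in> Points S" "p1 \<in> L1" "p1 \<in> s1"
    using subplane_meet_exists L(1,3) s(1) special_subplane_line lines(3) by blast
  obtain p2 where p2: "p2 \<in> Points S" "p2 \<in> L2" "p2 \<in> s2"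
    using subplane_meet_exists L(2,4) s(2) special_subplane_line lines(4) by blast
  have neq_D: "p1 \<noteq> D" "p2 \<noteq> D" using p1 p2 L by auto
  have unique: "M = s" if "M \<in> Lines Pl" "s \<in> Lines Pl" "D \<in> M" "D \<in> s" "p \<in> M" "p \<in> s" "p \<noteq> D"
    for M s p using that ambient_line_unique by metis
  have "p1 \<noteq> p2"
    using unique[OF lines(1,2)] lines(3,4) p1(3) p2(3) neq_D(1) s(3) by blast
  then obtain M where M: "M \<in> Lines S" "p1 \<in> M" "p2 \<in> M"
    using subplane_join_exists[OF p1(1) p2(1)] by blast
  moreover have "D \<notin> M"
    using unique[OF subplane_line[OF M(1)]] lines M(2,3) p1(3) p2(3) neq_D s(3) by metis
  ultimately show thesis
    using that p1 p2 lines(1,2) by (auto simp: concurrent_ambient_iff)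
qed

lemma subplane_quadrilateral_exists:
  assumes special: "s \<in> special" "s11 \<in> special" "s12 \<in> special" "s21 \<in> special" "s22 \<in> special"
    and neq: "s11 \<noteq> s12" "s21 \<noteq> s22" "s11 \<noteq> s21" "s12 \<noteq> s22"
  obtains L1 L2 M1 M2 where "{L1, L2, M1, M2} \<subseteq> Lines S" "\<forall>L\<in>{L1, L2, M1, M2}. D \<notin> L" "M1 \<noteq> M2"
    "concurrent Pl {s, L1, L2}"
    "concurrent Pl {s11, L1, M1}" "concurrent Pl {s12, L2, M1}"
    "concurrent Pl {s21, L1, M2}" "concurrent Pl {s22, L2, M2}"
proof -
  obtain p where p: "p \<in> Points S" "p \<in> s" "p \<noteq> D"
    using special_second_point[OF special(1)] .
  obtain L1 L2 where L: "L1 \<in> Lines S" "L2 \<in> Lines S" "D \<notin> L1" "D \<notin> L2"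
    and L_neq: "L1 \<noteq> L2" and p_on: "p \<in> L1" "p \<in> L2"
    using two_ordinary_lines_through_subplane_point[OF p(1,3)] by metis
  obtain M1 where M1: "M1 \<in> Lines S" "D \<notin> M1"
    "concurrent Pl {s11, L1, M1}" "concurrent Pl {s12, L2, M1}"
    using subplane_transversal_exists[OF L special(2,3) neq(1)] .
  obtain M2 where M2: "M2 \<in> Lines S" "D \<notin> M2"
    "concurrent Pl {s21, L1, M2}" "concurrent Pl {s22, L2, M2}"
    using subplane_transversal_exists[OF L special(4,5) neq(2)] .
  have "M1 \<noteq> M2"
  proof
    assume "M1 = M2"
    then have "L1 = M1" "L2 = M1"
      using special_through_meet_unique[OF special(2,4) _ _ _ L(3), of M1]
        special_through_meet_unique[OF special(3,5) _ _ _ L(4), of M1]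
        subplane_line L(1,2) M1 M2 neq(3,4) by blast+
    with L_neq show False by simp
  qed
  moreover have "concurrent Pl {s, L1, L2}"
    using p(2) p_on special(1) special_ambient_line by (auto simp: concurrent_ambient_iff)
  ultimately show thesis
    using that[of L1 L2 M1 M2] L M1 M2 by blast
qed

lemma perspective_meets_specialI:
  assumes "s \<in> special" "p \<in> s" "p \<in> L" "p \<in> M" "concurrent Pl {s, L', M'}"
  shows "perspective_meets Pl D L M L' M'"
proof -
  have "s \<in> Lines Pl" "D \<in> s" using assms(1) special_ambient_line D_in_special by auto
  moreover from this have "concurrent Pl {s, L, M}"
    using assms(2-4) by (auto simp: concurrent_ambient_iff)
  ultimately show ?thesis
    using assms(5) by (auto simp: perspective_meets_def lines_through_def Inc_ambient)
qed

lemma sixth_vertex_in_rect: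
  assumes sixth_vertex: "sixth_vertex_property Pl D"
    and L: "L1 \<in> Lines Pl" "L2 \<in> Lines Pl" "D \<notin> L1" "D \<notin> L2"
    and M: "M1 \<in> Lines Pl" "M2 \<in> Lines Pl" "D \<notin> M1" "D \<notin> M2"
    and triangles: "\<not> concurrent Pl {L1, L2, M1}" "\<not> concurrent Pl {L1, L2, M2}"
    and p: "p \<in> rect_points" "p \<in> L1" "p \<in> L2"
    and p11: "p11 \<in> rect_points" "p11 \<in> M1" "p11 \<in> L1"
    and p12: "p12 \<in> rect_points" "p12 \<in> M1" "p12 \<in> L2"
    and p21: "p21 \<in> rect_points" "p21 \<in> M2" "p21 \<in> L1"
    and p22: "p22 \<in> rect_points" "p22 \<in> M2" "p22 \<in> L2"
    and neq: "p11 \<noteq> p12" "p21 \<noteq> p22" "p11 \<noteq> p21" "p12 \<noteq> p22"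
  shows "\<exists>r\<in>rect_points. r \<in> M1 \<and> r \<in> M2"
proof -
  obtain s s11 s12 s21 s22 where
      special: "s \<in> special" "s11 \<in> special" "s12 \<in> special" "s21 \<in> special" "s22 \<in> special"
    and on_special: "p \<in> s" "p11 \<in> s11" "p12 \<in> s12" "p21 \<in> s21" "p22 \<in> s22"
    using p(1) p11(1) p12(1) p21(1) p22(1) by blast
  have "s11 \<noteq> s12" "s21 \<noteq> s22" "s11 \<noteq> s21" "s12 \<noteq> s22"
    using special_line_eq_iff special on_special L M p11 p12 p21 p22 neq by metis+
  then obtain L1' L2' M1' M2' where
      lines': "{L1', L2', M1', M2'} \<subseteq> Lines S" "\<forall>L\<in>{L1', L2', M1', M2'}. D \<notin> L" "M1' \<noteq> M2'"
    and vertices': "concurrent Pl {s, L1', L2'}"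
      "concurrent Pl {s11, L1', M1'}" "concurrent Pl {s12, L2', M1'}"
      "concurrent Pl {s21, L1', M2'}" "concurrent Pl {s22, L2', M2'}"
    using subplane_quadrilateral_exists[OF special] by blast
  have "perspective_meets Pl D M1 M2 M1' M2'"
  proof (rule sixth_vertex[unfolded sixth_vertex_property_def, rule_format])
    show "\<And>l. l \<in> {L1, L2, M1, M2, L1', L2', M1', M2'} \<Longrightarrow> l \<in> Lines Pl \<and> \<not> Inc Pl D l"
      using L M lines' subplane_line by (auto simp: Inc_ambient)
  qed (use triangles perspective_meets_specialI special on_special p p11 p12 p21 p22 vertices'
      in blast)+
  then obtain k r r' where k: "k \<in> Lines Pl" "D \<in> k" "r \<in> k" "r' \<in> k"
    and r: "r \<in> M1" "r \<in> M2" and r': "r' \<in> M1'" "r' \<in> M2'"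
    by (auto simp: perspective_meets_def lines_through_def Inc_ambient concurrent_def)
  obtain t where t: "t \<in> Points S" "t \<in> M1'" "t \<in> M2'"
    using subplane_meet_exists[of M1' M2'] lines'(1,3) by auto
  then have "r' = t"
    using ambient_line_unique[of M1' M2' r' t] lines'(1,3) r' subplane_line by auto
  with t have "r' \<in> Points S" by simp
  moreover have "r' \<noteq> D" using r'(1) lines'(2) by blast
  ultimately have "k \<in> special"
    using line_through_D_special[OF k(1,2,4)] subplane_points_subset_rect by blast
  then show ?thesis using r k(3) by blast
qed

lemma rect_lines_meet:
  assumes sixth_vertex: "sixth_vertex_property Pl D"
    and l: "l1 \<in> Lines rect" "l2 \<in> Lines rect" "D \<notin> l1" "D \<notin> l2"
    and m: "m1 \<in> Lines rect" "m2 \<in> Lines rect" "m1 \<noteq> m2"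
    and p: "p \<in> l1" "p \<in> l2"
    and p11: "p11 \<in> m1" "p11 \<in> l1" and p12: "p12 \<in> m1" "p12 \<in> l2"
    and p21: "p21 \<in> m2" "p21 \<in> l1" and p22: "p22 \<in> m2" "p22 \<in> l2"
    and neq: "distinct [p11, p12, p21, p22]"
  shows "\<exists>r\<in>rect_points. r \<in> m1 \<and> r \<in> m2"
proof -
  have in_rect: "p \<in> rect_points" if "p \<in> l" "l \<in> Lines rect" for p l
    using that rect_lineE by blast
  consider (special) "D \<in> m1 \<or> D \<in> m2"
    | (equal) "l1 = m1 \<or> l1 = m2 \<or> l2 = m1 \<or> l2 = m2"
    | (ordinary) "D \<notin> m1" "D \<notin> m2" "l1 \<noteq> m1" "l1 \<noteq> m2" "l2 \<noteq> m1" "l2 \<noteq> m2"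
    by blast
  then show ?thesis
  proof cases
    case special
    then show ?thesis using special_meets_rect_line m by metis
  next
    case equal
    then show ?thesis using p11 p12 p21 p22 in_rect l by blast
  next
    case ordinary
    obtain L1 L2 M1 M2 where lines: "L1 \<in> Lines Pl" "L2 \<in> Lines Pl" "M1 \<in> Lines Pl" "M2 \<in> Lines Pl"
      and restriction: "l1 = L1 \<inter> rect_points" "l2 = L2 \<inter> rect_points"
        "m1 = M1 \<inter> rect_points" "m2 = M2 \<inter> rect_points"
      using l m by (metis rect_lineE)
    have D: "D \<notin> L1" "D \<notin> L2" "D \<notin> M1" "D \<notin> M2"
      using restriction l m ordinary D_in_rect by blast+
    have "L1 \<noteq> M1" "L1 \<noteq> M2" "L2 \<noteq> M1" "L2 \<noteq> M2"
      using restriction ordinary by blast+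
    then have triangles: "\<not> concurrent Pl {L1, L2, M1}" "\<not> concurrent Pl {L1, L2, M2}"
      using not_concurrent_triangle[of L1 L2 M1 p11 p12]
        not_concurrent_triangle[of L1 L2 M2 p21 p22] lines restriction p11 p12 p21 p22 neq by auto
    have "\<exists>r\<in>rect_points. r \<in> M1 \<and> r \<in> M2"
      by (rule sixth_vertex_in_rect[OF sixth_vertex lines(1,2) D(1,2) lines(3,4) D(3,4) triangles,
            of p p11 p12 p21 p22])
        (use p p11 p12 p21 p22 neq restriction in auto)
    then show ?thesis using restriction by blast
  qed
qed

theorem projective_rectangle_rect:
  assumes "sixth_vertex_property Pl D"
  shows "projective_rectangle rect D"
  unfolding projective_rectangle_def Points_rect Inc_rect
proof (intro conjI ballI impI)
  fix l1 l2 m1 m2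
  assume lines: "l1 \<in> Lines rect" "l2 \<in> Lines rect" "m1 \<in> Lines rect" "m2 \<in> Lines rect"
    and l: "D \<notin> l1 \<and> D \<notin> l2 \<and> l1 \<noteq> l2 \<and> meet_in_point rect l1 l2"
    and m: "m1 \<noteq> m2 \<and>
      (\<exists>p11\<in>rect_points. \<exists>p12\<in>rect_points. \<exists>p21\<in>rect_points. \<exists>p22\<in>rect_points.
        distinct [p11, p12, p21, p22] \<and> p11 \<in> m1 \<and> p11 \<in> l1 \<and> p12 \<in> m1 \<and> p12 \<in> l2 \<and>
        p21 \<in> m2 \<and> p21 \<in> l1 \<and> p22 \<in> m2 \<and> p22 \<in> l2)"
  obtain p where "p \<in> l1" "p \<in> l2" using l by (auto simp: meet_in_point_def)
  moreover obtain p11 p12 p21 p22 where "distinct [p11, p12, p21, p22]"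
    "p11 \<in> m1" "p11 \<in> l1" "p12 \<in> m1" "p12 \<in> l2" "p21 \<in> m2" "p21 \<in> l1" "p22 \<in> m2" "p22 \<in> l2"
    using m by blast
  ultimately have "\<exists>r\<in>rect_points. r \<in> m1 \<and> r \<in> m2"
    using l m by (intro rect_lines_meet[OF assms lines(1,2) _ _ lines(3,4)]) blast+
  then show "meet_in_point rect m1 m2" by (simp add: meet_in_point_def)
next
  fix s l assume "s \<in> Lines rect" "l \<in> Lines rect" "D \<in> s \<and> l \<noteq> s"
  then show "\<exists>!p. p \<in> rect_points \<and> p \<in> s \<and> p \<in> l"
    using special_meets_rect_line by simp
qed (simp_all only: has_unique_joins_rect has_quadrangle_rect three_points_on_rect_line D_in_rect)

end

section \<open>Hyperplanes as kernels of functionals\<close>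

interpretation functional: vector_space_pair "(*s) :: 'a::field \<Rightarrow> 'a ^ 'n \<Rightarrow> 'a ^ 'n" "(*)"
  by unfold_locales

abbreviation functional :: "('a::field ^ 'n \<Rightarrow> 'a) \<Rightarrow> bool" where
  "functional \<equiv> Vector_Spaces.linear (*s) (*)"

definition hyperplane :: "('a::field ^ 'n) set \<Rightarrow> bool" where
  "hyperplane W \<longleftrightarrow> vec.subspace W \<and> vec.dim W + 1 = CARD('n)"

lemma span_hyperplane: "hyperplane W \<Longrightarrow> vec.span W = W"
  by (simp add: hyperplane_def)

lemma span_insert_hyperplane:
  fixes W :: "('a::field ^ 'n) set"
  assumes "hyperplane W" "d \<notin> W"
  shows "vec.span (insert d W) = UNIV"
proof -
  have "d \<notin> vec.span W" "vec.dim W + 1 = CARD('n)"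
    using assms by (simp_all add: span_hyperplane) (simp add: hyperplane_def)
  then have "vec.dim (insert d W) = CARD('n)" by (simp add: vec.dim_insert)
  then show ?thesis
    using vec.dim_eq_full[of "insert d W"] by (simp add: vec.dimension_def card_cart_basis)
qed

lemma hyperplane_decomposition:
  fixes W :: "('a::field ^ 'n) set"
  assumes "hyperplane W" "d \<notin> W"
  obtains w t where "w \<in> W" "x = w + t *s d"
proof -
  have "x \<in> vec.span (insert d W)" using span_insert_hyperplane[OF assms] by simp
  then obtain t where "x - t *s d \<in> W"
    using vec.span_breakdown_eq span_hyperplane[OF assms(1)] by blast
  with that[of "x - t *s d" t] show thesis by simp
qed

lemma hyperplane_eq_kernel:
  fixes W :: "('a::field ^ 'n) set"
  assumes W: "hyperplane W" and d: "d \<notin> W"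
  obtains f where "functional f" "f d = 1" "W = {x. f x = 0}"
proof -
  obtain B where B: "B \<subseteq> W" "vec.independent B" "W \<subseteq> vec.span B"
    using vec.basis_exists[of W] by metis
  then have span: "vec.span B = W"
    using W vec.span_minimal[of B W] by (simp add: hyperplane_def)
  have "vec.independent (insert d B)"
    using B(2) d span by (simp add: vec.independent_insertI)
  then obtain f where f: "functional f" "\<forall>b\<in>insert d B. f b = (if b = d then 1 else 0)"
    using functional.linear_independent_extend[of "insert d B" "\<lambda>b. if b = d then 1 else 0"]
    by blast
  interpret f: Vector_Spaces.linear "(*s)" "(*)" f by (fact f(1))
  have "f b = 0" if "b \<in> B" for b using f(2) that B(1) d by auto
  then have zero: "f w = 0" if "w \<in> W" for w
    using f.eq_0_on_span that span by blast
  have "f d = 1" using f(2) by simp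
  moreover have "W = {x. f x = 0}"
  proof (intro equalityI subsetI CollectI)
    fix x assume "x \<in> {x. f x = 0}"
    obtain w t where x: "w \<in> W" "x = w + t *s d"
      using hyperplane_decomposition[OF W d] .
    with \<open>x \<in> _\<close> have "t = 0" by (simp add: f.add f.scale zero \<open>f d = 1\<close>)
    with x show "x \<in> W" by simp
  qed (fact zero)
  ultimately show thesis using that f(1) by blast
qed

lemma functionals_proportional:
  fixes W :: "('a::field ^ 'n) set"
  assumes W: "hyperplane W" and f: "functional f" and g: "functional g"
    and vanish: "\<And>x. x \<in> W \<Longrightarrow> f x = 0" "\<And>x. x \<in> W \<Longrightarrow> g x = 0" and "g e \<noteq> 0"
  shows "\<exists>k. \<forall>x. f x = k * g x"
proof (intro exI allI)
  fix x
  interpret f: Vector_Spaces.linear "(*s)" "(*)" f by (fact f)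
  interpret g: Vector_Spaces.linear "(*s)" "(*)" g by (fact g)
  have "e \<notin> W" using vanish(2) \<open>g e \<noteq> 0\<close> by blast
  then obtain w t where "w \<in> W" "x = w + t *s e"
    using hyperplane_decomposition[OF W] by metis
  then show "f x = f e / g e * g x"
    using vanish \<open>g e \<noteq> 0\<close> by (simp add: f.add f.scale g.add g.scale)
qed

section \<open>The projective plane over a field\<close>

definition pg_line :: "('a::field ^ 3) set \<Rightarrow> ('a ^ 3) set set" where
  "pg_line W = {U \<in> PG2_points. U \<subseteq> W}"

lemma Lines_PG2: "Lines PG2 = {pg_line W | W. hyperplane W}"
  by (simp add: PG2_def pg_line_def hyperplane_def)

lemma Inc_PG2: "Inc PG2 = (\<in>)"
  by (simp add: PG2_def)

lemma Points_PG2: "Points PG2 = {vec.span {x} | x :: 'a::field ^ 3. x \<noteq> 0}"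
proof (intro equalityI subsetI)
  fix U :: "('a ^ 3) set" assume "U \<in> Points PG2"
  then have U: "vec.subspace U" "vec.dim U = 1" by (auto simp: PG2_def PG2_points_def)
  then have "\<not> U \<subseteq> {0}" using vec.dim_eq_0[of U] by simp
  then obtain x where x: "x \<in> U" "x \<noteq> 0" by blast
  have "vec.span {x} \<subseteq> U" using x(1) U(1) by (simp add: vec.span_minimal)
  then have "vec.span {x} = U"
    using x U by (intro vec.subspace_dim_equal) auto
  with x show "U \<in> {vec.span {x} | x. x \<noteq> 0}" by blast
qed (auto simp: PG2_def PG2_points_def)

lemma PG2_pointE:
  fixes p :: "('a::field ^ 3) set"
  assumes "p \<in> Points PG2"
  obtains x where "x \<noteq> 0" "p = vec.span {x}"
  using assms by (auto simp: Points_PG2)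

lemma span_in_pg_line_iff:
  assumes "hyperplane W" "x \<noteq> 0"
  shows "vec.span {x} \<in> pg_line W \<longleftrightarrow> x \<in> W"
proof -
  have "vec.span {x} \<in> PG2_points"
    using assms(2) by (auto simp: PG2_points_def)
  moreover have "vec.span {x} \<subseteq> W \<longleftrightarrow> x \<in> W"
    using assms(1) vec.span_superset[of "{x}"] vec.span_minimal[of "{x}" W]
    by (auto simp: hyperplane_def)
  ultimately show ?thesis by (simp add: pg_line_def)
qed

lemma pg_line_subset_Points: "pg_line W \<subseteq> Points PG2"
  by (auto simp: pg_line_def PG2_def)

lemma hyperplane_span_pair:
  fixes x y :: "'a::field ^ 3"
  assumes "x \<noteq> 0" "y \<noteq> 0" "vec.span {x} \<noteq> vec.span {y}"
  shows "hyperplane (vec.span {x, y})"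
proof -
  have "x \<notin> vec.span {y}"
  proof
    assume "x \<in> vec.span {y}"
    then have "vec.span {x} \<subseteq> vec.span {y}" by (simp add: vec.span_minimal)
    then have "vec.span {x} = vec.span {y}"
      using assms(1,2) by (intro vec.subspace_dim_equal) auto
    with assms(3) show False by blast
  qed
  then show ?thesis using assms(2) by (simp add: hyperplane_def vec.dim_insert)
qed

lemma hyperplane_eq_span_pair:
  fixes x y :: "'a::field ^ 3"
  assumes "x \<noteq> 0" "y \<noteq> 0" "vec.span {x} \<noteq> vec.span {y}"
    and W: "hyperplane W" "x \<in> W" "y \<in> W"
  shows "W = vec.span {x, y}"
proof (rule sym, rule vec.subspace_dim_equal)
  show "vec.span {x, y} \<subseteq> W"
    using W by (simp add: hyperplane_def vec.span_minimal)
  show "vec.dim W \<le> vec.dim (vec.span {x, y})"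
    using W(1) hyperplane_span_pair[OF assms(1-3)] unfolding hyperplane_def by linarith
qed (use W(1) in \<open>simp_all add: hyperplane_def\<close>)

lemma hyperplanes_meet:
  fixes V W :: "('a::field ^ 3) set"
  assumes "hyperplane V" "hyperplane W"
  obtains x where "x \<noteq> 0" "x \<in> V" "x \<in> W"
proof -
  have "vec.dim {x + y | x y. x \<in> V \<and> y \<in> W} + vec.dim (V \<inter> W) = vec.dim V + vec.dim W"
    using assms by (simp add: hyperplane_def vec.dim_sums_Int)
  moreover have "vec.dim V = 2" "vec.dim W = 2" using assms by (simp_all add: hyperplane_def)
  moreover have "vec.dim {x + y | x y. x \<in> V \<and> y \<in> W} \<le> CARD(3)"
    by (rule dim_subset_UNIV_cart_gen)
  ultimately have "0 < vec.dim (V \<inter> W)" by simp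
  then have "\<not> V \<inter> W \<subseteq> {0}" by (metis less_irrefl vec.dim_eq_0)
  then show thesis using that by blast
qed

lemma has_unique_joins_PG2: "has_unique_joins (PG2 :: (('a::field ^ 3) set, _) incidence_structure)"
  unfolding has_unique_joins_def Inc_PG2
proof (intro ballI impI)
  fix p q :: "('a ^ 3) set"
  assume "p \<in> Points PG2" "q \<in> Points PG2" and neq: "p \<noteq> q"
  then obtain x y where x: "x \<noteq> 0" "p = vec.span {x}" and y: "y \<noteq> 0" "q = vec.span {y}"
    by (metis PG2_pointE)
  let ?W = "vec.span {x, y}"
  have W: "hyperplane ?W" using hyperplane_span_pair x y neq by blast
  show "\<exists>!l. l \<in> Lines PG2 \<and> p \<in> l \<and> q \<in> l"
  proof (rule ex1I[of _ "pg_line ?W"])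
    show "pg_line ?W \<in> Lines PG2 \<and> p \<in> pg_line ?W \<and> q \<in> pg_line ?W"
      using W x y by (auto simp: Lines_PG2 span_in_pg_line_iff vec.span_base)
  next
    fix l assume l: "l \<in> Lines PG2 \<and> p \<in> l \<and> q \<in> l"
    then obtain V where "hyperplane V" "l = pg_line V" by (auto simp: Lines_PG2)
    with l show "l = pg_line ?W"
      using hyperplane_eq_span_pair[of x y V] x y neq by (simp add: span_in_pg_line_iff)
  qed
qed

lemma PG2_lines_meet:
  fixes l m :: "('a::field ^ 3) set set"
  assumes "l \<in> Lines PG2" "m \<in> Lines PG2"
  shows "\<exists>p\<in>Points PG2. p \<in> l \<and> p \<in> m"
proof -
  obtain V W where VW: "hyperplane V" "hyperplane W" "l = pg_line V" "m = pg_line W"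
    using assms by (auto simp: Lines_PG2)
  then obtain x where "x \<noteq> 0" "x \<in> V" "x \<in> W" using hyperplanes_meet by blast
  with VW have "vec.span {x} \<in> l" "vec.span {x} \<in> m" by (simp_all add: span_in_pg_line_iff)
  then show ?thesis using VW(3) pg_line_subset_Points by blast
qed

definition standard_frame :: "('a::field ^ 'n) set" where
  "standard_frame = insert 1 cart_basis"

lemma one_not_in_cart_basis:
  assumes "CARD('n) > 1"
  shows "(1 :: 'a::field ^ 'n) \<notin> cart_basis"
proof
  assume "(1 :: 'a ^ 'n) \<in> cart_basis"
  then obtain i where i: "(1 :: 'a ^ 'n) = axis i 1" by (auto simp: cart_basis_def)
  have "(UNIV :: 'n set) \<noteq> {i}" using assms by (metis card_1_singleton_iff nat_neq_iff One_nat_def)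
  then obtain j where "j \<noteq> i" by blast
  with arg_cong[OF i, of "\<lambda>x. x $ j"] show False by (simp add: axis_def)
qed

lemma card_standard_frame:
  assumes "CARD('n) > 1"
  shows "card (standard_frame :: ('a::field ^ 'n) set) = CARD('n) + 1"
  using one_not_in_cart_basis[OF assms, where ?'a = 'a]
  by (simp add: standard_frame_def card_cart_basis finite_cart_basis)

lemma span_standard_frame_minus:
  assumes "CARD('n) > 1"
  shows "vec.span (standard_frame - {z :: 'a::field ^ 'n}) = UNIV"
proof -
  let ?V = "vec.span (standard_frame - {z :: 'a ^ 'n})"
  have base: "x \<in> ?V" if "x \<in> standard_frame" "x \<noteq> z" for x
    using that by (simp add: vec.span_base)
  have axis: "axis i 1 \<in> standard_frame" for i
    by (auto simp: standard_frame_def cart_basis_def)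
  have "axis j 1 \<in> ?V" for j
  proof (cases "axis j 1 = z")
    case True
    then have "1 \<in> ?V"
      using one_not_in_cart_basis[OF assms, where ?'a = 'a]
      by (intro base) (auto simp: standard_frame_def cart_basis_def)
    moreover have "(\<Sum>i\<in>UNIV - {j}. axis i 1) \<in> ?V"
      using True by (intro vec.span_sum base axis) (auto simp: axis_eq_axis)
    moreover have "axis j 1 = 1 - (\<Sum>i\<in>UNIV - {j}. axis i (1 :: 'a))"
      using basis_expansion[of "1 :: 'a ^ 'n"] by (simp add: sum.remove[of UNIV j] eq_diff_eq)
    ultimately show ?thesis by (simp add: vec.span_diff)
  qed (simp add: axis base)
  then have "vec.span cart_basis \<subseteq> ?V"
    by (intro vec.span_minimal) (auto simp: cart_basis_def)
  then show ?thesis by auto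
qed

lemma hyperplane_not_superset_frame_subset:
  fixes W :: "('a::field ^ 'n) set"
  assumes "CARD('n) > 1" and W: "hyperplane W"
    and A: "A \<subseteq> standard_frame" "card A = CARD('n)"
  shows "\<not> A \<subseteq> W"
proof
  assume "A \<subseteq> W"
  have "finite A" using A(2) by (simp add: card_ge_0_finite)
  then have "card (standard_frame - A) = 1"
    using A card_standard_frame[OF assms(1), where ?'a = 'a] by (simp add: card_Diff_subset)
  then obtain z where "standard_frame - A = {z}" by (rule card_1_singletonE)
  then have "vec.span (standard_frame - {z}) \<subseteq> W"
    using \<open>A \<subseteq> W\<close> W by (intro vec.span_minimal) (auto simp: hyperplane_def)
  then have "W = UNIV" using span_standard_frame_minus[OF assms(1)] by blast
  then have "vec.dim W = CARD('n)" by (simp only: vec_dim_card)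
  with W show False by (simp add: hyperplane_def)
qed

lemma has_quadrangle_PG2: "has_quadrangle (PG2 :: (('a::field ^ 3) set, _) incidence_structure)"
proof -
  let ?pt = "\<lambda>x :: 'a ^ 3. vec.span {x}" and ?F = "standard_frame :: ('a ^ 3) set"
  have frame: "?F = {1, axis 1 1, axis 2 1, axis 3 1}"
    by (auto simp: standard_frame_def cart_basis_def) (metis exhaust_3)
  have nonzero: "x \<noteq> 0" if "x \<in> ?F" for x
    using that by (auto simp: frame axis_eq_0_iff)
  have "inj_on ?pt ?F"
  proof (rule inj_onI)
    fix x y assume xy: "x \<in> ?F" "y \<in> ?F" "?pt x = ?pt y"
    then have "x \<in> ?pt y" by (metis insertI1 vec.span_base)
    then obtain k where "x = k *s y" by (auto simp: vec.span_singleton)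
    with xy(1,2) show "x = y" by (auto simp: frame axis_def vec_eq_iff forall_3)
  qed
  moreover have "card ?F = 4"
    using card_standard_frame[where ?'a = 'a and ?'n = 3] by simp
  ultimately have "card (?pt ` ?F) = 4" by (simp add: card_image)
  moreover have "\<not> collinear_in PG2 T" if T: "T \<subseteq> ?pt ` ?F" "card T = 3" for T
  proof
    assume "collinear_in PG2 T"
    then obtain W where W: "hyperplane W" "T \<subseteq> pg_line W"
      by (auto simp: collinear_in_def Lines_PG2 Inc_PG2)
    obtain A where A: "A \<subseteq> ?F" "inj_on ?pt A" "T = ?pt ` A"
      using T(1) by (auto simp: subset_image_inj)
    then have "A \<subseteq> W" using W nonzero span_in_pg_line_iff[OF W(1)] by blast
    moreover have "card A = 3" using A T(2) by (simp add: card_image)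
    ultimately show False
      using hyperplane_not_superset_frame_subset[OF _ W(1) A(1)] by simp
  qed
  moreover have "?pt ` ?F \<subseteq> Points PG2" using nonzero by (auto simp: Points_PG2)
  ultimately have "quadrangle PG2 (?pt ` ?F)" by (simp add: quadrangle_def)
  then show ?thesis by (auto simp: has_quadrangle_iff)
qed

lemma projective_plane_PG2:
  "projective_plane (PG2 :: (('a::field ^ 3) set, _) incidence_structure)"
proof -
  have "\<exists>!p. p \<in> Points PG2 \<and> p \<in> l \<and> p \<in> m"
    if lm: "l \<in> Lines PG2" "m \<in> Lines PG2" "l \<noteq> m" for l m :: "('a ^ 3) set set"
  proof -
    obtain p where p: "p \<in> Points PG2" "p \<in> l" "p \<in> m"
      using PG2_lines_meet[OF lm(1,2)] by blast
    have "q = p" if "q \<in> Points PG2" "q \<in> l" "q \<in> m" for q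
      using has_unique_joins_PG2 p that lm unfolding has_unique_joins_def Inc_PG2 by metis
    with p show ?thesis by blast
  qed
  then show ?thesis
    using has_unique_joins_PG2 has_quadrangle_PG2 by (simp add: projective_plane_def Inc_PG2)
qed

section \<open>The sixth vertex property of the plane over a field\<close>

definition normalised_equation ::
    "'a::field ^ 3 \<Rightarrow> ('a ^ 3) set set \<Rightarrow> ('a ^ 3 \<Rightarrow> 'a) \<Rightarrow> bool" where
  "normalised_equation d L f \<longleftrightarrow>
     functional f \<and> f d = 1 \<and> (\<forall>x. x \<noteq> 0 \<longrightarrow> (vec.span {x} \<in> L \<longleftrightarrow> f x = 0))"

lemma normalised_equation_exists:
  assumes "L \<in> Lines PG2" "d \<noteq> 0" "vec.span {d} \<notin> L"
  obtains f where "normalised_equation d L f"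
proof -
  obtain W where W: "hyperplane W" "L = pg_line W"
    using assms(1) by (auto simp: Lines_PG2)
  then have "d \<notin> W" using assms(2,3) by (simp add: span_in_pg_line_iff)
  then obtain f where "functional f" "f d = 1" "W = {x. f x = 0}"
    using hyperplane_eq_kernel W(1) by blast
  then have "normalised_equation d L f"
    using W by (simp add: normalised_equation_def span_in_pg_line_iff)
  then show thesis by (rule that)
qed

lemma normalised_equation_zero:
  "normalised_equation d L f \<Longrightarrow> x \<noteq> 0 \<Longrightarrow> vec.span {x} \<in> L \<longleftrightarrow> f x = 0"
  by (simp add: normalised_equation_def)

lemma normalised_equation_base:
  assumes "normalised_equation d L f"
  shows "d \<noteq> 0" "vec.span {d} \<notin> L"
proof -
  interpret Vector_Spaces.linear "(*s)" "(*)" f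
    using assms by (simp add: normalised_equation_def)
  show "d \<noteq> 0" using assms by (auto simp: normalised_equation_def)
  then show "vec.span {d} \<notin> L" using assms by (simp add: normalised_equation_def)
qed

lemma normalised_equation_inject:
  assumes "L \<in> Lines PG2" "M \<in> Lines PG2" "normalised_equation d L f" "normalised_equation d M f"
  shows "L = M"
proof -
  have "p \<in> L \<longleftrightarrow> p \<in> M" if "p \<in> Points PG2" for p
    using that assms(3,4) by (auto simp: Points_PG2 normalised_equation_def)
  then show ?thesis
    using assms(1,2) pg_line_subset_Points by (auto simp: Lines_PG2)
qed

lemma normalised_equation_diff_vanishes:
  assumes f: "normalised_equation d L f" and g: "normalised_equation d M g"
    and x: "x \<noteq> 0" "f x = 0" "g x = 0"
    and W: "hyperplane W" "d \<in> W" "x \<in> W" and "y \<in> W"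
  shows "f y - g y = 0"
proof -
  have fg: "functional f" "functional g" "f d = 1" "g d = 1"
    using f g by (simp_all add: normalised_equation_def)
  interpret diff: Vector_Spaces.linear "(*s)" "(*)" "\<lambda>y. f y - g y"
    by (rule functional.linear_compose_sub[OF fg(1,2)])
  have "vec.span {d} \<noteq> vec.span {x}"
    using normalised_equation_base[OF f] normalised_equation_zero[OF f x(1)] x(2) by auto
  then have "W = vec.span {d, x}"
    using hyperplane_eq_span_pair normalised_equation_base(1)[OF f] x(1) W by blast
  with \<open>y \<in> W\<close> have "y \<in> vec.span {d, x}" by simp
  then show ?thesis
    by (rule diff.eq_0_on_span[rotated]) (use fg x in auto)
qed

lemma perspective_meets_imp_parallel:
  assumes lines: "L \<in> Lines PG2" "M \<in> Lines PG2" "L \<noteq> M"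
    and eqs: "normalised_equation d L a" "normalised_equation d M b"
      "normalised_equation d L' a'" "normalised_equation d M' b'"
    and persp: "perspective_meets PG2 (vec.span {d}) L M L' M'"
  shows "\<exists>k. \<forall>x. a' x - b' x = k * (a x - b x)"
proof -
  obtain p p' l where "p \<in> Points PG2" "p' \<in> Points PG2" "l \<in> Lines PG2"
    and p: "p \<in> L" "p \<in> M" "p' \<in> L'" "p' \<in> M'" "vec.span {d} \<in> l" "p \<in> l" "p' \<in> l"
    using persp by (auto simp: perspective_meets_def lines_through_def concurrent_def Inc_PG2)
  then obtain x x' W where x: "x \<noteq> 0" "x' \<noteq> 0" "p = vec.span {x}" "p' = vec.span {x'}"
    and W: "hyperplane W" "l = pg_line W"
    unfolding Points_PG2 Lines_PG2 by blast
  have zero: "a x = 0" "b x = 0" "a' x' = 0" "b' x' = 0"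
    using p x eqs by (simp_all add: normalised_equation_zero)
  have mem: "d \<in> W" "x \<in> W" "x' \<in> W"
    using p x W normalised_equation_base(1)[OF eqs(1)] by (simp_all add: span_in_pg_line_iff)
  have "a \<noteq> b" using normalised_equation_inject lines eqs(1,2) by blast
  then obtain e where "a e - b e \<noteq> 0" by (auto simp: fun_eq_iff)
  moreover have "functional (\<lambda>x. a x - b x)" "functional (\<lambda>x. a' x - b' x)"
    using eqs by (simp_all add: normalised_equation_def functional.linear_compose_sub)
  moreover have "a y - b y = 0" "a' y - b' y = 0" if "y \<in> W" for y
    using normalised_equation_diff_vanishes[OF eqs(1,2) x(1) zero(1,2) W(1) mem(1,2) that]
      normalised_equation_diff_vanishes[OF eqs(3,4) x(2) zero(3,4) W(1) mem(1,3) that] by auto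
  ultimately show ?thesis
    using functionals_proportional[OF W(1), of "\<lambda>x. a' x - b' x" "\<lambda>x. a x - b x"] by blast
qed

lemma parallel_imp_perspective_meets:
  assumes lines: "L \<in> Lines PG2" "M \<in> Lines PG2" "L' \<in> Lines PG2"
    and eqs: "normalised_equation d L a" "normalised_equation d M b"
      "normalised_equation d L' a'" "normalised_equation d M' b'"
    and parallel: "\<And>x. a' x - b' x = k * (a x - b x)"
  shows "perspective_meets PG2 (vec.span {d}) L M L' M'"
proof -
  obtain x where x: "x \<noteq> 0" "vec.span {x} \<in> L" "vec.span {x} \<in> M"
    using PG2_lines_meet[OF lines(1,2)] by (auto simp: Points_PG2)
  have base: "d \<noteq> 0" "vec.span {d} \<notin> L" using normalised_equation_base[OF eqs(1)] .
  then have points: "vec.span {d} \<in> Points PG2" "vec.span {x} \<in> Points PG2"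
    using x(1) by (auto simp: Points_PG2)
  then obtain l where l: "l \<in> Lines PG2" "vec.span {d} \<in> l" "vec.span {x} \<in> l"
    using has_unique_joins_PG2 base(2) x(2) unfolding has_unique_joins_def Inc_PG2 by metis
  then obtain W where W: "hyperplane W" "l = pg_line W" by (auto simp: Lines_PG2)
  obtain x' where x': "x' \<noteq> 0" "vec.span {x'} \<in> l" "vec.span {x'} \<in> L'"
    using PG2_lines_meet[OF l(1) lines(3)] by (auto simp: Points_PG2)
  have zero: "a x = 0" "b x = 0" "a' x' = 0"
    using x x' eqs by (simp_all add: normalised_equation_zero)
  have mem: "d \<in> W" "x \<in> W" "x' \<in> W"
    using l x x' W base(1) by (simp_all add: span_in_pg_line_iff)
  have "a x' - b x' = 0"
    by (rule normalised_equation_diff_vanishes[OF eqs(1,2) x(1) zero(1,2) W(1) mem])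
  then have "b' x' = 0" using parallel[of x'] zero(3) by simp
  then have "vec.span {x'} \<in> M'" using x'(1) eqs(4) by (simp add: normalised_equation_zero)
  moreover have "vec.span {x'} \<in> Points PG2" using x'(1) by (auto simp: Points_PG2)
  ultimately have "concurrent PG2 {l, L, M}" "concurrent PG2 {l, L', M'}"
    using points(2) l x(2,3) x'(2,3) by (auto simp: concurrent_def Inc_PG2)
  then show ?thesis
    using l by (auto simp: perspective_meets_def lines_through_def Inc_PG2)
qed

lemma parallel_triangles_homothetic:
  assumes lines: "L1 \<in> Lines PG2" "L2 \<in> Lines PG2" "M \<in> Lines PG2"
    and triangle: "\<not> concurrent PG2 {L1, L2, M}"
    and eqs: "normalised_equation d L1 a1" "normalised_equation d L2 a2" "normalised_equation d M b"
      "normalised_equation d L1' a1'" "normalised_equation d L2' a2'" "normalised_equation d M' b'"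
    and persp: "perspective_meets PG2 (vec.span {d}) L1 M L1' M'"
      "perspective_meets PG2 (vec.span {d}) L2 M L2' M'"
    and side: "\<And>x. a1' x - a2' x = k * (a1 x - a2 x)"
  shows "a1' x - b' x = k * (a1 x - b x)"
proof -
  have not_all: "\<not> (p \<in> L1 \<and> p \<in> L2 \<and> p \<in> M)" if "p \<in> Points PG2" for p
    using triangle that by (auto simp: concurrent_def Inc_PG2)
  have "L1 \<noteq> M" "L2 \<noteq> M"
    using PG2_lines_meet[OF lines(1,2)] not_all by blast+
  then obtain l m where l: "\<And>x. a1' x - b' x = l * (a1 x - b x)"
    and m: "\<And>x. a2' x - b' x = m * (a2 x - b x)"
    using perspective_meets_imp_parallel[OF lines(1,3) _ eqs(1,3,4,6) persp(1)]
      perspective_meets_imp_parallel[OF lines(2,3) _ eqs(2,3,5,6) persp(2)] by metis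
  obtain v where v: "v \<noteq> 0" "vec.span {v} \<in> L2" "vec.span {v} \<in> M"
    using PG2_lines_meet[OF lines(2,3)] by (auto simp: Points_PG2)
  then have "vec.span {v} \<notin> L1" using not_all[of "vec.span {v}"] by (auto simp: Points_PG2)
  with v have vertex: "a2 v = 0" "b v = 0" "a1 v \<noteq> 0"
    using eqs(1-3) by (simp_all add: normalised_equation_zero)
  have "l * a1 v = (a1' v - a2' v) + (a2' v - b' v)"
    using l[of v] vertex by simp
  also have "\<dots> = k * a1 v"
    unfolding side m using vertex by simp
  finally show ?thesis using l vertex(3) by simp
qed

theorem sixth_vertex_property_PG2:
  fixes D :: "('a::field ^ 3) set"
  assumes "D \<in> Points PG2"
  shows "sixth_vertex_property PG2 D"
  unfolding sixth_vertex_property_def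
proof (intro allI impI)
  fix L1 L2 M1 M2 L1' L2' M1' M2' :: "('a ^ 3) set set"
  assume "\<forall>L\<in>{L1, L2, M1, M2, L1', L2', M1', M2'}. L \<in> Lines PG2 \<and> \<not> Inc PG2 D L"
  then have lines: "L1 \<in> Lines PG2" "L2 \<in> Lines PG2" "M1 \<in> Lines PG2" "M2 \<in> Lines PG2"
      "M1' \<in> Lines PG2"
    and ordinary: "\<forall>L\<in>{L1, L2, M1, M2, L1', L2', M1', M2'}. L \<in> Lines PG2 \<and> D \<notin> L"
    by (simp_all add: Inc_PG2)
  assume triangles: "\<not> concurrent PG2 {L1, L2, M1}" "\<not> concurrent PG2 {L1, L2, M2}"
    and persp: "perspective_meets PG2 D L1 L2 L1' L2'"
      "perspective_meets PG2 D L1 M1 L1' M1'" "perspective_meets PG2 D L2 M1 L2' M1'"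
      "perspective_meets PG2 D L1 M2 L1' M2'" "perspective_meets PG2 D L2 M2 L2' M2'"
  obtain d where d: "d \<noteq> 0" "D = vec.span {d}" using assms by (rule PG2_pointE)
  have "\<exists>f. normalised_equation d L f" if "L \<in> Lines PG2" "D \<notin> L" for L
    using normalised_equation_exists that d by metis
  then obtain a1 a2 b1 b2 a1' a2' b1' b2' where
      eqs: "normalised_equation d L1 a1" "normalised_equation d L2 a2"
        "normalised_equation d M1 b1" "normalised_equation d M2 b2"
    and eqs': "normalised_equation d L1' a1'" "normalised_equation d L2' a2'"
        "normalised_equation d M1' b1'" "normalised_equation d M2' b2'"
    using ordinary by (metis insertCI)
  have "L1 \<noteq> L2"
    using triangles(1) PG2_lines_meet[OF lines(1,3)] by (auto simp: concurrent_def Inc_PG2)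
  then obtain k where side: "\<And>x. a1' x - a2' x = k * (a1 x - a2 x)"
    using perspective_meets_imp_parallel[OF lines(1,2) _ eqs(1,2) eqs'(1,2)] persp(1) d(2)
    by metis
  have homothetic: "a1' x - b1' x = k * (a1 x - b1 x)" "a1' x - b2' x = k * (a1 x - b2 x)" for x
    by (rule parallel_triangles_homothetic[OF lines(1-3) triangles(1)
          eqs(1-3) eqs'(1-3) persp(2,3)[unfolded d(2)] side])
      (rule parallel_triangles_homothetic[OF lines(1,2,4) triangles(2)
          eqs(1,2,4) eqs'(1,2,4) persp(4,5)[unfolded d(2)] side])
  have "b1' x - b2' x = k * (b1 x - b2 x)" for x
  proof -
    have "b1' x - b2' x = (a1' x - b2' x) - (a1' x - b1' x)" by simp
    also have "\<dots> = k * (b1 x - b2 x)" unfolding homothetic by (simp add: algebra_simps)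
    finally show ?thesis .
  qed
  then show "perspective_meets PG2 D M1 M2 M1' M2'"
    unfolding d(2) by (rule parallel_imp_perspective_meets[OF lines(3,4,5) eqs(3,4) eqs'(3,4)])
qed

section \<open>The rectangle of a subplane of the plane over a field\<close>

theorem theorem4p7:
  fixes q k :: nat
    and Pl :: "(('a::{field, finite} ^ 3) set, ('a ^ 3) set set) incidence_structure"
    and \<pi> :: "(('a ^ 3) set, ('a ^ 3) set set) incidence_structure"
    and D :: "('a ^ 3) set"
  assumes "primepow q"
    and "k > 1"
    and "CARD('a) = q ^ k"
    and "Pl = PG2"
    and "CARD('b::{field, finite}) = q"
    and "subplane \<pi> Pl"
    and "isomorphic_incidence \<pi> (PG2 :: (('b ^ 3) set, ('b ^ 3) set set) incidence_structure)"
    and "D \<in> Points \<pi>"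
  shows "projective_rectangle (subplane_rectangle Pl \<pi> D) D"
proof -
  interpret pointed_subplane PG2 \<pi> D
  proof
    show "L \<subseteq> Points PG2" if "L \<in> Lines PG2" for L :: "('a ^ 3) set set"
      using that pg_line_subset_Points by (auto simp: Lines_PG2)
  qed (use assms projective_plane_PG2 Inc_PG2 in auto)
  have "D \<in> Points PG2"
    using subplane_point D_in_subplane by blast
  then show ?thesis
    unfolding \<open>Pl = PG2\<close> by (intro projective_rectangle_rect sixth_vertex_property_PG2)
qed

end
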